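(* Let $\mathcal{I}$ be a finite implication algebra with set of minimal elements $M_I$ and implication profile $p=p_I$. Then (a) $p$ is decreasing; (b) $p$ is submodular; (c) for any nonempty $A\subseteq M_I$, the functions $p_A,q_A\colon\mathcal{P}(M_I\setminus A)\setminus\{\emptyset\}\to\mathbb{N}$ defined by $p_A(X)=p(X\cup A)$ and $q_A(X)=p(X)-p(X\cup A)$ are both decreasing and submodular.
   Context: An implication algebra is a set with a binary operation $\to$ satisfying $(x\to y)\to x=x$, $(x\to y)\to y=(y\to x)\to x$, $x\to(y\to z)=y\to(x\to z)$; ordered by $x\le y$ iff $x\to y=\mathbf{1}$ it is a join-semilattice with top $\mathbf{1}$ whose principal filters are Boolean algebras. $M_I$ is the set of minimal elements, and the implication profile $p_I\colon\mathcal{P}(M_I)\setminus\{\emptyset\}\to\mathbb{N}$ is defined by $p_I(S)=k$ iff $[\bigvee S,\mathbf{1}]\cong 2^k$. For a function $f$ defined on the nonempty subsets of a finite set $N$: $f$ is decreasing if $S_1\subseteq S_2$ implies $f(S_1)\ge f(S_2)$; $f$ is submodular (in this paper's sense) if for all $S_1,S_2\subseteq N$ with $S_1\cap S_2\neq\emptyset$ we have $f(S_1)+f(S_2)\le f(S_1\cup S_2)+f(S_1\cap S_2)$. *)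

theory Defs
  imports Main
begin

locale implication_algebra =
  fixes carr :: "'a set"
    and imp :: "'a \<Rightarrow> 'a \<Rightarrow> 'a"  (infixr "\<rightarrow>" 60)
  assumes imp_closed: "\<lbrakk>x \<in> carr; y \<in> carr\<rbrakk> \<Longrightarrow> x \<rightarrow> y \<in> carr"
    and imp_contract: "\<lbrakk>x \<in> carr; y \<in> carr\<rbrakk> \<Longrightarrow> (x \<rightarrow> y) \<rightarrow> x = x"
    and imp_quasi_comm: "\<lbrakk>x \<in> carr; y \<in> carr\<rbrakk> \<Longrightarrow> (x \<rightarrow> y) \<rightarrow> y = (y \<rightarrow> x) \<rightarrow> x"
    and imp_exchange:
      "\<lbrakk>x \<in> carr; y \<in> carr; z \<in> carr\<rbrakk> \<Longrightarrow> x \<rightarrow> (y \<rightarrow> z) = y \<rightarrow> (x \<rightarrow> z)"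
begin

text \<open>The axioms make \<open>x \<rightarrow> x\<close> independent of \<open>x\<close>; the top element is this common value.\<close>

definition unit_elem :: 'a
  where "unit_elem = (THE e. e \<in> carr \<and> (\<forall>x\<in>carr. x \<rightarrow> x = e))"

definition le :: "'a \<Rightarrow> 'a \<Rightarrow> bool"
  where "le x y \<longleftrightarrow> x \<rightarrow> y = unit_elem"

definition minimals :: "'a set"
  where "minimals = {m \<in> carr. \<forall>x\<in>carr. le x m \<longrightarrow> x = m}"

definition is_join :: "'a set \<Rightarrow> 'a \<Rightarrow> bool"
  where "is_join S s \<longleftrightarrow>
    s \<in> carr \<and> (\<forall>x\<in>S. le x s) \<and> (\<forall>u\<in>carr. (\<forall>x\<in>S. le x u) \<longrightarrow> le s u)"

definition join :: "'a set \<Rightarrow> 'a"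
  where "join S = (THE s. is_join S s)"

definition interval :: "'a \<Rightarrow> 'a \<Rightarrow> 'a set"
  where "interval a b = {x \<in> carr. le a x \<and> le x b}"

text \<open>\<open>B \<cong> 2\<^sup>k\<close>, with \<open>2\<^sup>k\<close> realised as the power set of \<open>{..<k}\<close>.  An isomorphism of
  Boolean algebras is the same thing as an isomorphism of the underlying orders.\<close>

definition iso_cube :: "'a set \<Rightarrow> nat \<Rightarrow> bool"
  where "iso_cube B k \<longleftrightarrow>
    (\<exists>f. bij_betw f B (Pow {..<k}) \<and> (\<forall>x\<in>B. \<forall>y\<in>B. le x y \<longleftrightarrow> f x \<subseteq> f y))"

text \<open>Only meaningful on nonempty subsets of \<^term>\<open>minimals\<close>.\<close>

definition profile :: "'a set \<Rightarrow> nat"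
  where "profile S = (THE k. iso_cube (interval (join S) unit_elem) k)"

end

text \<open>In the next two definitions the domain of \<open>f\<close> is the set of nonempty subsets of \<open>N\<close>.\<close>

definition decreasing_on :: "'a set \<Rightarrow> ('a set \<Rightarrow> 'b::order) \<Rightarrow> bool"
  where "decreasing_on N f \<longleftrightarrow> antimono_on (Pow N - {{}}) f"

text \<open>The inequality is reversed with respect to the usual notion of submodularity, and is only
  required for pairs of sets that meet.\<close>

definition submodular_on :: "'a set \<Rightarrow> ('a set \<Rightarrow> 'b::ordered_ab_semigroup_add) \<Rightarrow> bool"
  where "submodular_on N f \<longleftrightarrow>
    (\<forall>S\<^sub>1 S\<^sub>2. S\<^sub>1 \<subseteq> N \<longrightarrow> S\<^sub>2 \<subseteq> N \<longrightarrow> S\<^sub>1 \<inter> S\<^sub>2 \<noteq> {} \<longrightarrow>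
      f S\<^sub>1 + f S\<^sub>2 \<le> f (S\<^sub>1 \<union> S\<^sub>2) + f (S\<^sub>1 \<inter> S\<^sub>2))"

text \<open>The function \<open>q\<^sub>A\<close> is formed in the integers, so that its subtraction is not truncated.\<close>

definition p_sub :: "('a set \<Rightarrow> nat) \<Rightarrow> 'a set \<Rightarrow> 'a set \<Rightarrow> nat"
  where "p_sub p A X = p (X \<union> A)"

definition q_sub :: "('a set \<Rightarrow> nat) \<Rightarrow> 'a set \<Rightarrow> 'a set \<Rightarrow> int"
  where "q_sub p A X = int (p X) - int (p (X \<union> A))"

end

(* In a finite implication algebra a coatom d satisfies u \<rightarrow> v \<le> d iff v \<le> d and not u \<le> d.  Hence the
   order is determined by the sets of coatoms above the elements, and in [a, 1] every set of coatoms
   above a arises in this way.  So [a, 1] is a cube whose dimension is the number of coatoms above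
   a, and p(S) counts the coatoms lying above all elements of S.  Everything then follows by
   counting: the common upper coatoms C(S) satisfy C(S \<union> T) = C(S) \<inter> C(T) and
   C(S) \<union> C(T) \<subseteq> C(S \<inter> T), and the same holds inside C(A) and outside C(A). *)
theory Submission
  imports Defs
begin

section \<open>Arithmetic of implication: the unit, the order and finite joins\<close>

context implication_algebra
begin

text \<open>Contraction replaces the first \<open>x\<close> by
  \<open>(x \<rightarrow> y) \<rightarrow> x\<close>; what results is contraction again, now for
  \<open>x \<rightarrow> y\<close> and \<open>x\<close>.\<close>

lemma imp_absorb: "\<lbrakk>x \<in> carr; y \<in> carr\<rbrakk> \<Longrightarrow> x \<rightarrow> (x \<rightarrow> y) = x \<rightarrow> y"
  by (metis imp_closed imp_contract)

text \<open>Write the first \<open>x\<close> as \<open>(x \<rightarrow> y) \<rightarrow> x\<close>,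
  exchange the roles of \<open>x \<rightarrow> y\<close> and \<open>x\<close> by
  quasi-commutativity, then absorb.\<close>

lemma imp_self_eq_imp: "\<lbrakk>x \<in> carr; y \<in> carr\<rbrakk> \<Longrightarrow> x \<rightarrow> x = (x \<rightarrow> y) \<rightarrow> (x \<rightarrow> y)"
  by (metis imp_absorb imp_closed imp_contract imp_quasi_comm)

lemma imp_self_const:
  assumes "x \<in> carr" "y \<in> carr"
  shows "x \<rightarrow> x = y \<rightarrow> y"
proof -
  \<comment> \<open>The element \<open>(u \<rightarrow> v) \<rightarrow> v\<close> is symmetric in
    \<open>u\<close> and \<open>v\<close> by quasi-commutativity, so it links
    \<open>x \<rightarrow> x\<close> to \<open>y \<rightarrow> y\<close>.\<close>
  have *: "u \<rightarrow> u = ((u \<rightarrow> v) \<rightarrow> v) \<rightarrow> ((u \<rightarrow> v) \<rightarrow> v)" if "u \<in> carr" "v \<in> carr" for u v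
    using imp_self_eq_imp[of u v] imp_self_eq_imp[of "u \<rightarrow> v" v] that imp_closed by simp
  show ?thesis
    using *[of x y] *[of y x] imp_quasi_comm[of x y] assms by simp
qed

lemma imp_self: "x \<in> carr \<Longrightarrow> x \<rightarrow> x = unit_elem"
  unfolding unit_elem_def
  by (rule the_equality[symmetric]) (auto intro: imp_closed imp_self_const)

lemma unit_closed: "x \<in> carr \<Longrightarrow> unit_elem \<in> carr"
  by (metis imp_closed imp_self)

lemma unit_imp: "x \<in> carr \<Longrightarrow> unit_elem \<rightarrow> x = x"
  by (metis imp_contract imp_self)

lemma imp_unit: "x \<in> carr \<Longrightarrow> x \<rightarrow> unit_elem = unit_elem"
  by (metis imp_absorb imp_self)

lemma le_refl: "x \<in> carr \<Longrightarrow> le x x"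
  by (simp add: le_def imp_self)

lemma le_unit: "x \<in> carr \<Longrightarrow> le x unit_elem"
  by (simp add: le_def imp_unit)

lemma le_antisym: "\<lbrakk>x \<in> carr; y \<in> carr; le x y; le y x\<rbrakk> \<Longrightarrow> x = y"
  by (metis imp_quasi_comm le_def unit_imp)

lemma unit_le_iff: "x \<in> carr \<Longrightarrow> le unit_elem x \<longleftrightarrow> x = unit_elem"
  by (auto simp: le_def unit_imp)

lemma le_trans:
  assumes "x \<in> carr" "y \<in> carr" "z \<in> carr" "le x y" "le y z"
  shows "le x z"
proof -
  \<comment> \<open>For \<open>le y z\<close> the other side of quasi-commutativity is
    \<open>unit_elem \<rightarrow> z\<close>. In this form of \<open>z\<close>, exchange brings
    \<open>x\<close> directly in front of \<open>y\<close>.\<close>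
  have "z = (z \<rightarrow> y) \<rightarrow> y"
    using assms by (metis imp_quasi_comm le_def unit_imp)
  then have "x \<rightarrow> z = (z \<rightarrow> y) \<rightarrow> (x \<rightarrow> y)"
    using assms by (metis imp_closed imp_exchange)
  then show ?thesis
    using assms by (simp add: le_def imp_unit imp_closed)
qed

lemma le_imp: "\<lbrakk>x \<in> carr; y \<in> carr\<rbrakk> \<Longrightarrow> le y (x \<rightarrow> y)"
  by (simp add: le_def imp_exchange[of y x y] imp_self imp_unit)

lemma le_join_left: "\<lbrakk>x \<in> carr; y \<in> carr\<rbrakk> \<Longrightarrow> le x ((x \<rightarrow> y) \<rightarrow> y)"
  by (simp add: le_def imp_exchange[of x "x \<rightarrow> y" y] imp_self imp_closed)

lemma imp_antimono: "\<lbrakk>x \<in> carr; y \<in> carr; z \<in> carr; le x y\<rbrakk> \<Longrightarrow> le (y \<rightarrow> z) (x \<rightarrow> z)"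
  using imp_exchange[of "y \<rightarrow> z" x z] le_trans[of x y "(y \<rightarrow> z) \<rightarrow> z"] le_join_left[of y z]
  by (simp add: le_def imp_closed)

lemma imp_mono:
  assumes "x \<in> carr" "y \<in> carr" "z \<in> carr" "le x y"
  shows "le (z \<rightarrow> x) (z \<rightarrow> y)"
proof -
  have "y = (y \<rightarrow> x) \<rightarrow> x"
    using assms by (metis imp_quasi_comm le_def unit_imp)
  then have "z \<rightarrow> y = (y \<rightarrow> x) \<rightarrow> (z \<rightarrow> x)"
    using assms by (metis imp_closed imp_exchange)
  then show ?thesis
    using assms by (simp add: le_imp imp_closed)
qed

text \<open>Antitonicity applied twice bounds the term by
  \<open>(z \<rightarrow> y) \<rightarrow> y\<close>, which is \<open>z\<close>. With
  \<open>le_join_left\<close> and \<open>le_imp\<close> this makes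
  \<open>(x \<rightarrow> y) \<rightarrow> y\<close> the binary join.\<close>

lemma join_le:
  assumes "x \<in> carr" "y \<in> carr" "z \<in> carr" "le x z" "le y z"
  shows "le ((x \<rightarrow> y) \<rightarrow> y) z"
proof -
  have "(z \<rightarrow> y) \<rightarrow> y = z"
    using assms by (metis imp_quasi_comm le_def unit_imp)
  then show ?thesis
    using imp_antimono[of "z \<rightarrow> y" "x \<rightarrow> y" y] imp_antimono[of x z y] assms
    by (simp add: imp_closed)
qed

lemma is_join_exists:
  assumes "finite S" "S \<noteq> {}" "S \<subseteq> carr"
  shows "\<exists>s. is_join S s"
  using assms
proof (induction rule: finite_ne_induct)
  case (singleton x)
  then show ?case
    by (auto simp: is_join_def intro!: exI[of _ x] le_refl)
next
  case (insert x S)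
  then obtain s where s: "is_join S s" "s \<in> carr" and x: "x \<in> carr"
    by (auto simp: is_join_def)
  have "is_join (insert x S) ((x \<rightarrow> s) \<rightarrow> s)"
    unfolding is_join_def
  proof (intro conjI ballI impI)
    fix y assume "y \<in> insert x S"
    then show "le y ((x \<rightarrow> s) \<rightarrow> s)"
      using s x insert.prems le_join_left[of x s] le_imp[of "x \<rightarrow> s" s]
        le_trans[of y s "(x \<rightarrow> s) \<rightarrow> s"]
      by (auto simp: is_join_def imp_closed)
  qed (use s x in \<open>auto simp: is_join_def imp_closed intro: join_le\<close>)
  then show ?case ..
qed

lemma is_join_join:
  assumes "finite S" "S \<noteq> {}" "S \<subseteq> carr"
  shows "is_join S (join S)"
proof -
  obtain s where s: "is_join S s"
    using is_join_exists[OF assms] ..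
  show ?thesis
    unfolding join_def
    by (rule theI[of "is_join S"], rule s)
      (use s in \<open>auto simp: is_join_def intro: le_antisym\<close>)
qed

section \<open>Coatoms and how implication sits below them\<close>

definition coatoms :: "'a set"
  where "coatoms = {d \<in> carr. d \<noteq> unit_elem \<and> (\<forall>x\<in>carr. le d x \<longrightarrow> x = d \<or> x = unit_elem)}"

lemma coatoms_subset: "coatoms \<subseteq> carr"
  by (auto simp: coatoms_def)

text \<open>Since \<open>x \<rightarrow> d\<close> lies above \<open>d\<close>, it is
  \<open>d\<close> or the unit, and the unit would mean \<open>le x d\<close>.\<close>

lemma imp_coatom:
  assumes "d \<in> coatoms" "x \<in> carr" "\<not> le x d"
  shows "x \<rightarrow> d = d"
  using assms le_imp[of x d] imp_closed[of x d] by (auto simp: coatoms_def le_def)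

lemma imp_le_coatom_iff:
  assumes "d \<in> coatoms" "u \<in> carr" "v \<in> carr"
  shows "le (u \<rightarrow> v) d \<longleftrightarrow> le v d \<and> \<not> le u d"
proof
  have d: "d \<in> carr" "d \<noteq> unit_elem"
    using assms by (auto simp: coatoms_def)
  {
    assume uvd: "le (u \<rightarrow> v) d"
    have "\<not> le u d"
    proof
      assume "le u d"
      \<comment> \<open>This is the join of \<open>u \<rightarrow> v\<close> and \<open>u\<close>;
        contraction reduces it to \<open>u \<rightarrow> u\<close>, the unit, which is not below a
        coatom.\<close>
      then have "le (((u \<rightarrow> v) \<rightarrow> u) \<rightarrow> u) d"
        using join_le[of "u \<rightarrow> v" u d] uvd assms d by (simp add: imp_closed)
      then show False
        using assms d by (simp add: imp_contract imp_self unit_le_iff)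
    qed
    moreover have "le v d"
      using le_trans[of v "u \<rightarrow> v" d] uvd assms d le_imp by (simp add: imp_closed)
    ultimately show "le v d \<and> \<not> le u d"
      by simp
  next
    assume vd: "le v d \<and> \<not> le u d"
    then have "le (u \<rightarrow> v) (u \<rightarrow> d)"
      using imp_mono assms d by simp
    then show "le (u \<rightarrow> v) d"
      using imp_coatom[of d u] vd assms by simp
  }
qed

text \<open>Counting elements recovers the dimension, so the description in \<open>profile\<close>
  is unambiguous.\<close>

lemma iso_cube_unique:
  assumes "iso_cube B k" "iso_cube B l"
  shows "k = l"
proof -
  have "card B = 2 ^ n" if "iso_cube B n" for n
    using that by (auto simp: iso_cube_def card_Pow dest: bij_betw_same_card)
  then show ?thesis
    using assms by (metis power_inject_exp one_less_numeral_iff semiring_norm(76))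
qed

end

section \<open>Finite algebras: coatoms determine the order, and principal filters are cubes\<close>

locale finite_implication_algebra = implication_algebra +
  assumes finite_carr: "finite carr"
begin

lemma finite_coatoms: "finite coatoms"
  using coatoms_subset finite_carr by (rule finite_subset)

text \<open>Climb from \<open>x\<close>: an element strictly between \<open>x\<close> and the unit
  has fewer elements above it.\<close>

lemma coatom_above:
  assumes "x \<in> carr" "x \<noteq> unit_elem"
  shows "\<exists>d\<in>coatoms. le x d"
  using assms
proof (induction "card {y \<in> carr. le x y}" arbitrary: x rule: less_induct)
  case less
  show ?case
  proof (cases "x \<in> coatoms")
    case True
    then show ?thesis
      using le_refl less.prems by blast
  next
    case False
    then obtain y where y: "y \<in> carr" "le x y" "y \<noteq> x" "y \<noteq> unit_elem"
      using less.prems by (auto simp: coatoms_def)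
    have "\<not> le y x"
      using y less.prems le_antisym by blast
    then have "{z \<in> carr. le y z} \<subset> {z \<in> carr. le x z}"
      using y(1,2) less.prems(1) le_refl[of x] le_trans[OF less.prems(1) y(1) _ y(2)]
      by auto
    then have "card {z \<in> carr. le y z} < card {z \<in> carr. le x z}"
      using finite_carr by (intro psubset_card_mono) simp_all
    then obtain d where d: "d \<in> coatoms" "le y d"
      using less.hyps[of y] y(1,4) by blast
    moreover have "le x d"
      using d coatoms_subset less.prems(1) y(1,2) by (intro le_trans[of x y d]) auto
    ultimately show ?thesis
      by blast
  qed
qed

lemma le_iff_coatoms:
  assumes "x \<in> carr" "y \<in> carr"
  shows "le x y \<longleftrightarrow> (\<forall>d\<in>coatoms. le y d \<longrightarrow> le x d)"
proof
  assume "le x y"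
  then show "\<forall>d\<in>coatoms. le y d \<longrightarrow> le x d"
    using assms coatoms_subset le_trans by blast
next
  assume *: "\<forall>d\<in>coatoms. le y d \<longrightarrow> le x d"
  show "le x y"
  proof (rule ccontr)
    assume "\<not> le x y"
    \<comment> \<open>By \<open>imp_le_coatom_iff\<close> such a \<open>d\<close> is above
      \<open>y\<close> but not above \<open>x\<close>.\<close>
    then obtain d where "d \<in> coatoms" "le (x \<rightarrow> y) d"
      using coatom_above[of "x \<rightarrow> y"] assms by (auto simp: le_def imp_closed)
    then show False
      using * assms by (auto simp: imp_le_coatom_iff)
  qed
qed

text \<open>Start from the unit, which is below no coatom, and add one coatom at a time by taking
  meets.\<close>

lemma coatoms_above_surj:
  assumes a: "a \<in> carr" and "finite T" "T \<subseteq> {d \<in> coatoms. le a d}"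
  shows "\<exists>x\<in>carr. le a x \<and> {d \<in> coatoms. le x d} = T"
  using assms(2,3)
proof (induction rule: finite_induct)
  case empty
  then show ?case
    using unit_closed[OF a] le_unit[OF a] coatoms_subset unit_le_iff
    by (intro bexI[of _ unit_elem]) (auto simp: coatoms_def)
next
  case (insert c T)
  then obtain x where x: "x \<in> carr" "le a x" "{d \<in> coatoms. le x d} = T"
    by auto
  have c: "c \<in> coatoms" "c \<in> carr" "le a c"
    using insert.prems coatoms_subset by auto
  \<comment> \<open>the meet of \<open>x\<close> and \<open>c\<close> in the Boolean algebra above \<open>a\<close>\<close>
  let ?m = "(x \<rightarrow> (c \<rightarrow> a)) \<rightarrow> a"
  have "le ?m d \<longleftrightarrow> le a d \<and> (le x d \<or> le c d)" if "d \<in> coatoms" for d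
    using that a x c by (auto simp: imp_le_coatom_iff imp_closed)
  moreover have "le c d \<longleftrightarrow> d = c" if "d \<in> coatoms" for d
    using that c le_refl[of c] by (auto simp: coatoms_def)
  ultimately have "{d \<in> coatoms. le ?m d} = insert c T"
    using insert.prems x by blast
  moreover have "?m \<in> carr" "le a ?m"
    using a x c by (auto simp: imp_closed le_imp)
  ultimately show ?case
    by blast
qed

lemma iso_cube_interval:
  assumes a: "a \<in> carr"
  shows "iso_cube (interval a unit_elem) (card {d \<in> coatoms. le a d})"
proof -
  define K where "K = {d \<in> coatoms. le a d}"
  \<comment> \<open>The set of coatoms above \<open>x\<close> shrinks as \<open>x\<close> grows; its
    complement in \<open>K\<close> makes the map monotone.\<close>
  define f where "f x = {d \<in> K. \<not> le x d}" for x
  have mem: "x \<in> interval a unit_elem \<longleftrightarrow> x \<in> carr \<and> le a x" for x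
    by (auto simp: interval_def le_unit)
  have above: "le x d \<Longrightarrow> d \<in> K" if "d \<in> coatoms" "x \<in> carr" "le a x" for x d
    using le_trans[of a x d] that a coatoms_subset by (auto simp: K_def)
  have le_iff: "le x y \<longleftrightarrow> f x \<subseteq> f y" if "x \<in> carr" "le a x" "y \<in> carr" "le a y" for x y
    using that above[of _ y] by (auto simp: le_iff_coatoms f_def K_def)
  have "f ` interval a unit_elem = Pow K"
  proof
    show "Pow K \<subseteq> f ` interval a unit_elem"
    proof
      fix T assume "T \<in> Pow K"
      moreover have "finite (K - T)"
        using finite_coatoms by (simp add: K_def)
      ultimately obtain x where "x \<in> carr" "le a x" "{d \<in> coatoms. le x d} = K - T"
        using coatoms_above_surj[OF a, of "K - T"] by (auto simp: K_def)
      then have "x \<in> interval a unit_elem" "f x = T"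
        using \<open>T \<in> Pow K\<close> by (auto simp: mem f_def K_def)
      then show "T \<in> f ` interval a unit_elem"
        by blast
    qed
  qed (auto simp: f_def)
  moreover have "inj_on f (interval a unit_elem)"
    using le_iff by (intro inj_onI) (auto simp: mem intro!: le_antisym)
  ultimately have f: "bij_betw f (interval a unit_elem) (Pow K)"
    by (simp add: bij_betw_def)
  \<comment> \<open>Numbering the coatoms turns \<open>Pow K\<close> into the standard cube of
    \<open>iso_cube\<close>.\<close>
  obtain h where h: "bij_betw h K {..<card K}"
    using ex_bij_betw_finite_nat[of K] finite_coatoms by (auto simp: K_def lessThan_atLeast0)
  then have "bij_betw (\<lambda>x. h ` f x) (interval a unit_elem) (Pow {..<card K})"
    using bij_betw_trans[OF f bij_betw_Pow[OF h]] by (simp add: comp_def)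
  moreover have "h ` f x \<subseteq> h ` f y \<longleftrightarrow> f x \<subseteq> f y" for x y
  proof -
    have "f x \<subseteq> K" "f y \<subseteq> K" "inj_on h K"
      using h by (auto simp: f_def bij_betw_def)
    then show ?thesis
      by (metis image_mono inv_into_image_cancel)
  qed
  ultimately show ?thesis
    unfolding iso_cube_def K_def[symmetric]
    by (intro exI[of _ "\<lambda>x. h ` f x"]) (auto simp: mem le_iff)
qed

text \<open>A coatom is above the join of \<open>S\<close> exactly when it is above every member of
  \<open>S\<close>.\<close>

lemma profile_eq:
  assumes "S \<subseteq> carr" "S \<noteq> {}"
  shows "profile S = card {d \<in> coatoms. \<forall>x\<in>S. le x d}"
proof -
  have j: "is_join S (join S)"
    using assms finite_carr by (intro is_join_join) (auto intro: finite_subset)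
  then have "join S \<in> carr"
    by (simp add: is_join_def)
  then have "profile S = card {d \<in> coatoms. le (join S) d}"
    unfolding profile_def
    by (blast intro: iso_cube_interval iso_cube_unique)
  also have "{d \<in> coatoms. le (join S) d} = {d \<in> coatoms. \<forall>x\<in>S. le x d}"
    using j coatoms_subset assms(1) le_trans[of _ "join S"] unfolding is_join_def by blast
  finally show ?thesis .
qed

end

section \<open>Counting lemmas, and their application to the profile\<close>

lemma decreasing_on_card:
  assumes "\<And>S. S \<subseteq> N \<Longrightarrow> S \<noteq> {} \<Longrightarrow> finite (C S)"
    and "\<And>S. S \<subseteq> N \<Longrightarrow> S \<noteq> {} \<Longrightarrow> f S = of_nat (card (C S))"
    and "\<And>S T. S \<subseteq> T \<Longrightarrow> C T \<subseteq> C S"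
  shows "decreasing_on N (f :: 'a set \<Rightarrow> 'b::linordered_semidom)"
  unfolding decreasing_on_def
  using assms by (intro monotone_onI) (simp add: card_mono)

lemma submodular_on_card:
  assumes fin: "\<And>S. S \<subseteq> N \<Longrightarrow> S \<noteq> {} \<Longrightarrow> finite (C S)"
    and f: "\<And>S. S \<subseteq> N \<Longrightarrow> S \<noteq> {} \<Longrightarrow> f S = of_nat (card (C S))"
    and anti: "\<And>S T. S \<subseteq> T \<Longrightarrow> C T \<subseteq> C S"
    and un: "\<And>S T. C (S \<union> T) = C S \<inter> C T"
  shows "submodular_on N (f :: 'a set \<Rightarrow> 'b::linordered_semidom)"
  unfolding submodular_on_def
proof (intro allI impI)
  fix S T assume *: "S \<subseteq> N" "T \<subseteq> N" "S \<inter> T \<noteq> {}"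
  then have ne: "S \<noteq> {}" "T \<noteq> {}" "S \<union> T \<noteq> {}" "S \<union> T \<subseteq> N" "S \<inter> T \<subseteq> N"
    by auto
  have "card (C S) + card (C T) = card (C S \<union> C T) + card (C S \<inter> C T)"
    using * ne fin by (intro card_Un_Int) auto
  \<comment> \<open>That \<open>S\<close> and \<open>T\<close> meet matters here:
    \<open>C (S \<inter> T)\<close> is known to be finite only for a nonempty argument.\<close>
  also have "card (C S \<union> C T) \<le> card (C (S \<inter> T))"
    using fin[OF ne(5) *(3)] anti[of "S \<inter> T" S] anti[of "S \<inter> T" T] by (intro card_mono) auto
  finally have "card (C S) + card (C T) \<le> card (C (S \<union> T)) + card (C (S \<inter> T))"
    by (simp add: un)
  then show "f S + f T \<le> f (S \<union> T) + f (S \<inter> T)"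
    using f * ne by (simp flip: of_nat_add)
qed

theorem theorem4p3:
  fixes I :: "'a set" and imp :: "'a \<Rightarrow> 'a \<Rightarrow> 'a"
    and M :: "'a set" and p :: "'a set \<Rightarrow> nat"
  assumes "implication_algebra I imp"
    and "finite I"
    and "M = implication_algebra.minimals I imp"
    and "p = implication_algebra.profile I imp"
  shows "decreasing_on M p \<and>
    submodular_on M p \<and>
    (\<forall>A. A \<subseteq> M \<and> A \<noteq> {} \<longrightarrow>
      decreasing_on (M - A) (p_sub p A) \<and>
      submodular_on (M - A) (p_sub p A) \<and>
      (\<forall>X. X \<subseteq> M - A \<and> X \<noteq> {} \<longrightarrow> q_sub p A X \<in> \<nat>) \<and>
      decreasing_on (M - A) (q_sub p A) \<and>
      submodular_on (M - A) (q_sub p A))"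
proof -
  interpret finite_implication_algebra I imp
    using assms by (simp add: finite_implication_algebra_def finite_implication_algebra_axioms_def)
  define C where "C S = {d \<in> coatoms. \<forall>x\<in>S. le x d}" for S
  have fin: "finite (C S)" for S
    using finite_coatoms by (simp add: C_def)
  have anti: "C T \<subseteq> C S" if "S \<subseteq> T" for S T
    using that by (auto simp: C_def)
  have un: "C (S \<union> T) = C S \<inter> C T" for S T
    by (auto simp: C_def)
  have p: "p S = card (C S)" if "S \<subseteq> M" "S \<noteq> {}" for S
    using profile_eq[of S] that assms(3,4) by (auto simp: C_def minimals_def)
  have p': "p S = of_nat (card (C S))" if "S \<subseteq> M" "S \<noteq> {}" for S
    using p[OF that] by simp
  have "decreasing_on M p"
    using fin p' anti by (rule decreasing_on_card)
  moreover have "submodular_on M p"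
    using fin p' anti un by (rule submodular_on_card)
  moreover have "decreasing_on (M - A) (p_sub p A) \<and>
      submodular_on (M - A) (p_sub p A) \<and>
      (\<forall>X. X \<subseteq> M - A \<and> X \<noteq> {} \<longrightarrow> q_sub p A X \<in> \<nat>) \<and>
      decreasing_on (M - A) (q_sub p A) \<and>
      submodular_on (M - A) (q_sub p A)" if A: "A \<subseteq> M" "A \<noteq> {}" for A
  proof -
    \<comment> \<open>Intersecting every \<open>C X\<close> with a fixed set, or removing that set,
      keeps \<open>C\<close> antitone and still sends unions to intersections. Hence the counting
      lemmas apply to both families.\<close>
    have pA: "p_sub p A X = of_nat (card (C X \<inter> C A))" if "X \<subseteq> M - A" "X \<noteq> {}" for X
      using p[of "X \<union> A"] that A by (auto simp: p_sub_def un)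
    have qA: "q_sub p A X = of_nat (card (C X - C A))" if "X \<subseteq> M - A" "X \<noteq> {}" for X
    proof -
      have "card (C X) = card (C X - C A) + card (C X \<inter> C A)"
        using fin[of X] by (simp add: card_Diff_subset_Int card_mono)
      then show ?thesis
        using p[of X] p[of "X \<union> A"] that A by (simp add: q_sub_def un le_supI subset_trans[OF _ Diff_subset])
    qed
    have "decreasing_on (M - A) (p_sub p A)"
      by (rule decreasing_on_card[of _ "\<lambda>X. C X \<inter> C A", OF _ pA]) (use fin in \<open>auto dest: subsetD[OF anti]\<close>)
    moreover have "submodular_on (M - A) (p_sub p A)"
      by (rule submodular_on_card[of _ "\<lambda>X. C X \<inter> C A", OF _ pA]) (use fin un in \<open>auto dest: subsetD[OF anti]\<close>)
    moreover have "decreasing_on (M - A) (q_sub p A)"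
      by (rule decreasing_on_card[of _ "\<lambda>X. C X - C A", OF _ qA]) (use fin in \<open>auto dest: subsetD[OF anti]\<close>)
    moreover have "submodular_on (M - A) (q_sub p A)"
      by (rule submodular_on_card[of _ "\<lambda>X. C X - C A", OF _ qA]) (use fin un in \<open>auto dest: subsetD[OF anti]\<close>)
    ultimately show ?thesis
      \<comment> \<open>As the image of a cardinality, \<open>q_sub p A X\<close> is a natural
        number, although the subtraction is in the integers.\<close>
      using qA by simp
  qed
  ultimately show ?thesis
    by blast
qed

end
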